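(* Let $G$ be a bipartite graph with at least one edge, with parts $X$ and $Y$ where $0<|X|=m\leq n=|Y|$. Then for every $B\in\mathcal{B}(G)$, $q(G)\leq 2\,q(BB^T)+1$.
   Context: All graphs are finite and simple. For a graph $G$ with vertex set $\{1,\dots,n\}$, $S(G)$ denotes the set of all real symmetric $n\times n$ matrices $A=[a_{ij}]$ such that for $i\neq j$, $a_{ij}\neq 0$ if and only if $\{i,j\}$ is an edge of $G$ (diagonal entries are arbitrary). For a square matrix $A$, $q(A)$ is the number of distinct eigenvalues of $A$, and $q(G)=\min\{q(A): A\in S(G)\}$. For a bipartite graph $G$ with parts $X,Y$, $0<|X|=m\leq n=|Y|$, $\mathcal{B}(G)$ is the set of real $m\times n$ matrices $B=[b_{ij}]$ with rows indexed by $X$ and columns indexed by $Y$ such that $b_{ij}\neq 0$ if and only if $\{i,j\}\in E(G)$. *)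

theory Defs
  imports Jordan_Normal_Form.Spectral_Radius Jordan_Normal_Form.DL_Missing_Sublist
begin

text \<open>A graph has vertex set \<open>{..<N}\<close> (matrix indices start at 0) and a set \<open>E\<close> of
  two-element subsets of it as edges.\<close>

definition simple_graph :: "nat \<Rightarrow> nat set set \<Rightarrow> bool" where
  "simple_graph N E \<longleftrightarrow> (\<forall>e\<in>E. e \<subseteq> {..<N} \<and> card e = 2)"

definition bipartite_with_parts :: "nat \<Rightarrow> nat set set \<Rightarrow> nat set \<Rightarrow> nat set \<Rightarrow> bool" where
  "bipartite_with_parts N E X Y \<longleftrightarrow>
     simple_graph N E \<and> X \<union> Y = {..<N} \<and> X \<inter> Y = {} \<and>
     (\<forall>e\<in>E. \<exists>x\<in>X. \<exists>y\<in>Y. e = {x, y})"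

definition graph_sym_mats :: "nat \<Rightarrow> nat set set \<Rightarrow> real mat set" where
  "graph_sym_mats N E =
     {A \<in> carrier_mat N N. transpose_mat A = A \<and>
        (\<forall>i<N. \<forall>j<N. i \<noteq> j \<longrightarrow> (A $$ (i, j) \<noteq> 0 \<longleftrightarrow> {i, j} \<in> E))}"

text \<open>Eigenvalues of a real square matrix are taken in the complex numbers; for symmetric
  matrices they are all real.\<close>

definition num_distinct_eigenvalues :: "real mat \<Rightarrow> nat" where
  "num_distinct_eigenvalues A = card (spectrum (map_mat complex_of_real A))"

definition graph_q :: "nat \<Rightarrow> nat set set \<Rightarrow> nat" where
  "graph_q N E = (INF A \<in> graph_sym_mats N E. num_distinct_eigenvalues A)"

text \<open>The infimum above is a minimum, since \<open>graph_sym_mats N E\<close> contains the adjacency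
  matrix.\<close>

lemma graph_sym_mats_nonempty: "graph_sym_mats N E \<noteq> {}"
proof -
  have "mat N N (\<lambda>(i, j). if {i, j} \<in> E then 1 else 0) \<in> graph_sym_mats N E"
    unfolding graph_sym_mats_def by (auto simp: insert_commute)
  then show ?thesis by blast
qed

lemma graph_q_attained:
  "\<exists>A \<in> graph_sym_mats N E. graph_q N E = num_distinct_eigenvalues A"
  using Inf_nat_def1[of "num_distinct_eigenvalues ` graph_sym_mats N E"]
    graph_sym_mats_nonempty[of N E]
  unfolding graph_q_def by auto

text \<open>Rows and columns are indexed by \<open>X\<close> and \<open>Y\<close> in increasing order: \<open>pick X i\<close> is the
  \<open>i\<close>-th smallest element of \<open>X\<close>, counting from 0.\<close>

definition biadjacency_mats :: "nat set set \<Rightarrow> nat set \<Rightarrow> nat set \<Rightarrow> real mat set" where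
  "biadjacency_mats E X Y =
     {B \<in> carrier_mat (card X) (card Y).
        \<forall>i<card X. \<forall>j<card Y. B $$ (i, j) \<noteq> 0 \<longleftrightarrow> {pick X i, pick Y j} \<in> E}"

end

theory Submission
  imports Defs
begin

text \<open>For \<open>B \<in> \<B>(G)\<close> the symmetric matrix \<open>A\<close> with off-diagonal blocks \<open>B\<close> and \<open>B\<^sup>T\<close> and zero
  diagonal blocks lies in \<open>S(G)\<close>. If \<open>(u, w)\<close> is an eigenvector of \<open>A\<close> for \<open>k\<close>, then \<open>B w = k u\<close> and
  \<open>B\<^sup>T u = k w\<close>, hence \<open>B B\<^sup>T u = k\<^sup>2 u\<close>. So either \<open>k\<^sup>2\<close> is an eigenvalue of \<open>B B\<^sup>T\<close>, or \<open>u = 0\<close> and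
  then \<open>w \<noteq> 0\<close> forces \<open>k = 0\<close>. As each eigenvalue of \<open>B B\<^sup>T\<close> has at most two square roots, \<open>A\<close> has at
  most \<open>2 q(B B\<^sup>T) + 1\<close> distinct eigenvalues.\<close>

lemma bij_betw_pick:
  assumes "finite I"
  shows "bij_betw (pick I) {..<card I} I"
proof -
  have inj: "inj_on (pick I) {..<card I}"
    by (rule inj_onI) (metis card_pick_le lessThan_iff)
  have "pick I ` {..<card I} \<subseteq> I"
    using pick_in_set_le by auto
  with assms inj have "pick I ` {..<card I} = I"
    by (simp add: card_image card_subset_eq)
  with inj show ?thesis by (simp add: bij_betw_def)
qed

text \<open>The parts \<open>X\<close> and \<open>Y\<close> may interleave in \<open>{..<N}\<close>,
  so the four blocks of \<open>A\<close> are described entrywise through \<open>pick\<close> and not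
  as contiguous blocks. The field is arbitrary because eigenvalues are later taken over the complex
  numbers.\<close>

lemma eigenvalue_bipartite_matrix:
  fixes A B :: "'a :: field mat"
  assumes A: "A \<in> carrier_mat N N" and B: "B \<in> carrier_mat (card X) (card Y)"
    and XY: "X \<union> Y = {..<N}" "X \<inter> Y = {}"
    and upper: "\<And>p q. p < card X \<Longrightarrow> q < card Y \<Longrightarrow> A $$ (pick X p, pick Y q) = B $$ (p, q)"
    and lower: "\<And>p q. p < card X \<Longrightarrow> q < card Y \<Longrightarrow> A $$ (pick Y q, pick X p) = B $$ (p, q)"
    and diag_X: "\<And>i j. i \<in> X \<Longrightarrow> j \<in> X \<Longrightarrow> A $$ (i, j) = 0"
    and diag_Y: "\<And>i j. i \<in> Y \<Longrightarrow> j \<in> Y \<Longrightarrow> A $$ (i, j) = 0"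
    and k: "eigenvalue A k"
  shows "k = 0 \<or> eigenvalue (B * transpose_mat B) (k\<^sup>2)"
proof -
  have fin: "finite X" "finite Y"
    using XY(1) by (metis finite_Un finite_lessThan)+
  from k A obtain v where v: "v \<in> carrier_vec N" "v \<noteq> 0\<^sub>v N" "A *\<^sub>v v = k \<cdot>\<^sub>v v"
    unfolding eigenvalue_def eigenvector_def by auto
  \<comment> \<open>Summing over \<open>X \<union> Y\<close> lets the zero diagonal blocks delete
    the half of the sum that lies in the part of \<open>i\<close>.\<close>
  have row: "(\<Sum>j\<in>X \<union> Y. A $$ (i, j) * v $ j) = k * v $ i" if "i < N" for i
  proof -
    have "(A *\<^sub>v v) $ i = (\<Sum>j<N. A $$ (i, j) * v $ j)"
      using that A v(1) by (simp add: scalar_prod_def atLeast0LessThan)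
    then show ?thesis using v that XY(1) by simp
  qed
  \<comment> \<open>The restrictions of \<open>v\<close> to the two parts, renumbered to match the
    rows and columns of \<open>B\<close>.\<close>
  define u where "u = vec (card X) (\<lambda>p. v $ pick X p)"
  define w where "w = vec (card Y) (\<lambda>q. v $ pick Y q)"
  have uw[simp]: "u \<in> carrier_vec (card X)" "w \<in> carrier_vec (card Y)"
    by (auto simp: u_def w_def)
  have Bw: "B *\<^sub>v w = k \<cdot>\<^sub>v u"
  proof (rule eq_vecI)
    fix p assume "p < dim_vec (k \<cdot>\<^sub>v u)"
    then have p: "p < card X" by (simp add: u_def)
    then have pX: "pick X p \<in> X" using pick_in_set_le by blast
    have "(B *\<^sub>v w) $ p = (\<Sum>q<card Y. A $$ (pick X p, pick Y q) * v $ pick Y q)"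
      using p B upper by (simp add: scalar_prod_def atLeast0LessThan w_def)
    also have "\<dots> = (\<Sum>j\<in>Y. A $$ (pick X p, j) * v $ j)"
      by (rule sum.reindex_bij_betw[OF bij_betw_pick[OF fin(2)]])
    also have "\<dots> = (\<Sum>j\<in>X \<union> Y. A $$ (pick X p, j) * v $ j)"
      using fin diag_X pX by (intro sum.mono_neutral_left) auto
    also have "\<dots> = k * v $ pick X p"
      using pX XY(1) by (intro row) auto
    finally show "(B *\<^sub>v w) $ p = (k \<cdot>\<^sub>v u) $ p"
      using p by (simp add: u_def)
  qed (use B in \<open>simp add: u_def\<close>)
  have Btu: "transpose_mat B *\<^sub>v u = k \<cdot>\<^sub>v w"
  proof (rule eq_vecI)
    fix q assume "q < dim_vec (k \<cdot>\<^sub>v w)"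
    then have q: "q < card Y" by (simp add: w_def)
    then have qY: "pick Y q \<in> Y" using pick_in_set_le by blast
    have "(transpose_mat B *\<^sub>v u) $ q = (\<Sum>p<card X. A $$ (pick Y q, pick X p) * v $ pick X p)"
      using q B lower by (simp add: scalar_prod_def atLeast0LessThan u_def)
    also have "\<dots> = (\<Sum>j\<in>X. A $$ (pick Y q, j) * v $ j)"
      by (rule sum.reindex_bij_betw[OF bij_betw_pick[OF fin(1)]])
    also have "\<dots> = (\<Sum>j\<in>X \<union> Y. A $$ (pick Y q, j) * v $ j)"
      using fin diag_Y qY by (intro sum.mono_neutral_left) auto
    also have "\<dots> = k * v $ pick Y q"
      using qY XY(1) by (intro row) auto
    finally show "(transpose_mat B *\<^sub>v u) $ q = (k \<cdot>\<^sub>v w) $ q"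
      using q by (simp add: w_def)
  qed (use B in \<open>simp add: w_def\<close>)
  have "(B * transpose_mat B) *\<^sub>v u = B *\<^sub>v (transpose_mat B *\<^sub>v u)"
    using B by (intro assoc_mult_mat_vec) auto
  also have "\<dots> = k \<cdot>\<^sub>v (k \<cdot>\<^sub>v u)"
    using B by (simp add: Btu Bw mult_mat_vec)
  finally have BBu: "(B * transpose_mat B) *\<^sub>v u = k\<^sup>2 \<cdot>\<^sub>v u"
    by (simp add: smult_smult_assoc power2_eq_square)
  show ?thesis
  proof (cases "u = 0\<^sub>v (card X)")
    case False
    with BBu B have "eigenvector (B * transpose_mat B) u (k\<^sup>2)"
      unfolding eigenvector_def by simp
    then show ?thesis unfolding eigenvalue_def by blast
  next
    case True
    \<comment> \<open>On \<open>X\<close> this is \<open>u = 0\<close>. On \<open>Y\<close> it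
      follows from \<open>Btu\<close>: \<open>k\<close> times \<open>w\<close> equals the image of
      \<open>u = 0\<close>, and \<open>k\<close> can be cancelled. Since \<open>v\<close> is
      nonzero, only \<open>k = 0\<close> remains.\<close>
    have "v $ i = 0" if "k \<noteq> 0" "i < N" for i
    proof (cases "i \<in> X")
      case iX: True
      then obtain p where "p < card X" "i = pick X p"
        using bij_betw_pick[OF fin(1)] unfolding bij_betw_def by blast
      then show ?thesis using arg_cong[OF True, of "\<lambda>x. x $ p"] by (simp add: u_def)
    next
      case False
      with that XY(1) have "i \<in> Y" by blast
      then obtain q where q: "q < card Y" "i = pick Y q"
        using bij_betw_pick[OF fin(2)] unfolding bij_betw_def by blast
      have "(transpose_mat B *\<^sub>v u) $ q = 0"
        using True B q by (simp add: scalar_prod_def)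
      then have "(k \<cdot>\<^sub>v w) $ q = 0" by (simp add: Btu)
      then show ?thesis using q that(1) by (simp add: w_def)
    qed
    then have "v = 0\<^sub>v N" if "k \<noteq> 0"
      using that v(1) by (intro eq_vecI) auto
    with v(2) show ?thesis by blast
  qed
qed

text \<open>Every square root of a point of \<open>S\<close> is its principal root
  \<open>csqrt\<close> or the negative of that, so two images of \<open>S\<close> cover the
  preimage.\<close>

lemma card_square_preimage_le:
  fixes S :: "complex set"
  assumes "finite S"
  shows "finite {z. z\<^sup>2 \<in> S}" "card {z. z\<^sup>2 \<in> S} \<le> 2 * card S"
proof -
  have sub: "{z. z\<^sup>2 \<in> S} \<subseteq> csqrt ` S \<union> (\<lambda>z. - csqrt z) ` S"
  proof
    fix z assume "z \<in> {z. z\<^sup>2 \<in> S}"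
    moreover have "z = csqrt (z\<^sup>2) \<or> z = - csqrt (z\<^sup>2)"
      by (metis power2_csqrt power2_eq_iff)
    ultimately show "z \<in> csqrt ` S \<union> (\<lambda>z. - csqrt z) ` S" by blast
  qed
  then show "finite {z. z\<^sup>2 \<in> S}"
    by (rule finite_subset) (simp add: assms)
  have "card {z. z\<^sup>2 \<in> S} \<le> card (csqrt ` S \<union> (\<lambda>z. - csqrt z) ` S)"
    using sub assms by (intro card_mono) auto
  also have "\<dots> \<le> card (csqrt ` S) + card ((\<lambda>z. - csqrt z) ` S)"
    by (rule card_Un_le)
  also have "\<dots> \<le> 2 * card S"
    using card_image_le[OF assms, of csqrt] card_image_le[OF assms, of "\<lambda>z. - csqrt z"] by simp
  finally show "card {z. z\<^sup>2 \<in> S} \<le> 2 * card S" .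
qed

text \<open>The cardinality \<open>card {a\<in>X. a < i}\<close> is the rank of \<open>i\<close> in
  \<open>X\<close>, which inverts \<open>pick X\<close>. It turns a vertex into a row index of
  \<open>B\<close>, and likewise a vertex of \<open>Y\<close> into a column index.\<close>

definition bipartite_matrix :: "nat \<Rightarrow> nat set \<Rightarrow> nat set \<Rightarrow> 'a :: zero mat \<Rightarrow> 'a mat" where
  "bipartite_matrix N X Y B =
     mat N N (\<lambda>(i, j).
       if i \<in> X \<and> j \<in> Y then B $$ (card {a\<in>X. a < i}, card {a\<in>Y. a < j})
       else if i \<in> Y \<and> j \<in> X then B $$ (card {a\<in>X. a < j}, card {a\<in>Y. a < i})
       else 0)"

lemma card_less_element:
  fixes I :: "nat set"
  assumes "finite I" "i \<in> I"
  shows "card {a\<in>I. a < i} < card I"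
  using assms by (intro psubset_card_mono) auto

lemma bipartite_matrix_in_graph_sym_mats:
  assumes G: "bipartite_with_parts N E X Y" and B: "B \<in> biadjacency_mats E X Y"
  shows "bipartite_matrix N X Y B \<in> graph_sym_mats N E"
proof -
  from G have XY: "X \<union> Y = {..<N}" "X \<inter> Y = {}"
    and E: "\<And>e. e \<in> E \<Longrightarrow> \<exists>x\<in>X. \<exists>y\<in>Y. e = {x, y}"
    unfolding bipartite_with_parts_def by auto
  have fin: "finite X" "finite Y"
    using XY(1) by (metis finite_Un finite_lessThan)+
  let ?A = "bipartite_matrix N X Y B"
  have sym: "?A $$ (i, j) = ?A $$ (j, i)" if "i < N" "j < N" for i j
    using that XY(2) by (auto simp: bipartite_matrix_def)
  have entry: "?A $$ (i, j) \<noteq> 0 \<longleftrightarrow> {i, j} \<in> E" if "i \<in> X" "j \<in> Y" for i j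
  proof -
    have "i < N" "j < N" using that XY(1) by auto
    with that have "?A $$ (i, j) = B $$ (card {a\<in>X. a < i}, card {a\<in>Y. a < j})"
      by (simp add: bipartite_matrix_def)
    then show ?thesis
      \<comment> \<open>The ranks are valid indices of \<open>B\<close>, and \<open>pick\<close>
        sends them back to \<open>i\<close> and \<open>j\<close>.\<close>
      using B card_less_element[OF fin(1) that(1)] card_less_element[OF fin(2) that(2)]
        pick_card_in_set[OF that(1)] pick_card_in_set[OF that(2)]
      unfolding biadjacency_mats_def by simp
  qed
  \<comment> \<open>Every edge meets both of the disjoint parts. The case \<open>i = j\<close> is
    included, so the diagonal needs no separate treatment below.\<close>
  have no_edge: "{i, j} \<notin> E" if "i \<in> X \<and> j \<in> X \<or> i \<in> Y \<and> j \<in> Y" for i j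
  proof
    assume "{i, j} \<in> E"
    then obtain x y where xy: "x \<in> X" "y \<in> Y" "{i, j} = {x, y}" using E by blast
    then have "x = i \<or> x = j" "y = i \<or> y = j" by (auto simp: doubleton_eq_iff)
    with xy(1,2) that XY(2) show False by blast
  qed
  have "?A $$ (i, j) \<noteq> 0 \<longleftrightarrow> {i, j} \<in> E" if ij: "i < N" "j < N" for i j
  proof -
    consider "i \<in> X" "j \<in> Y" | "i \<in> Y" "j \<in> X" | "i \<in> X" "j \<in> X" | "i \<in> Y" "j \<in> Y"
      using ij XY(1) by blast
    then show ?thesis
    proof cases
      case 1 then show ?thesis by (rule entry)
    next
      case 2 then show ?thesis using entry[of j i] sym[OF ij] by (simp add: insert_commute)
    next
      case 3
      then have "{i, j} \<notin> E" by (intro no_edge) simp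
      moreover have "?A $$ (i, j) = 0" using 3 ij XY(2) by (auto simp: bipartite_matrix_def)
      ultimately show ?thesis by simp
    next
      case 4
      then have "{i, j} \<notin> E" by (intro no_edge) simp
      moreover have "?A $$ (i, j) = 0" using 4 ij XY(2) by (auto simp: bipartite_matrix_def)
      ultimately show ?thesis by simp
    qed
  qed
  moreover have "?A \<in> carrier_mat N N" by (simp add: bipartite_matrix_def)
  moreover from this have "transpose_mat ?A = ?A"
    using sym by (intro eq_matI) auto
  ultimately show ?thesis unfolding graph_sym_mats_def by blast
qed

lemma spectrum_bipartite_matrix_subset:
  fixes B :: "'a :: field mat"
  assumes B: "B \<in> carrier_mat (card X) (card Y)"
    and XY: "X \<union> Y = {..<N}" "X \<inter> Y = {}"
  shows "spectrum (bipartite_matrix N X Y B)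
    \<subseteq> insert 0 {k. k\<^sup>2 \<in> spectrum (B * transpose_mat B)}"
proof
  let ?A = "bipartite_matrix N X Y B"
  have in_N: "i < N" if "i \<in> X \<or> i \<in> Y" for i using that XY(1) by auto
  fix k assume "k \<in> spectrum ?A"
  then have "eigenvalue ?A k" by (simp add: spectrum_def)
  have "k = 0 \<or> eigenvalue (B * transpose_mat B) (k\<^sup>2)"
  proof (rule eigenvalue_bipartite_matrix[OF _ B XY _ _ _ _ \<open>eigenvalue ?A k\<close>])
    fix p q assume pq: "p < card X" "q < card Y"
    then have "pick X p \<in> X" "pick Y q \<in> Y" using pick_in_set_le by blast+
    with in_N pq XY(2) show "?A $$ (pick X p, pick Y q) = B $$ (p, q)"
      "?A $$ (pick Y q, pick X p) = B $$ (p, q)"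
      \<comment> \<open>By \<open>card_pick_le\<close> the rank of \<open>pick X p\<close> in
        \<open>X\<close> is \<open>p\<close>, and similarly for \<open>Y\<close>.\<close>
      by (auto simp: bipartite_matrix_def card_pick_le)
  qed (use in_N XY(2) in \<open>auto simp: bipartite_matrix_def\<close>)
  then show "k \<in> insert 0 {k. k\<^sup>2 \<in> spectrum (B * transpose_mat B)}"
    by (simp add: spectrum_def)
qed

theorem theorem6p1:
  fixes N m n :: nat and E :: "nat set set" and X Y :: "nat set" and B :: "real mat"
  assumes "bipartite_with_parts N E X Y"
    and "E \<noteq> {}"
    and "card X = m" and "card Y = n"
    and "0 < m" and "m \<le> n"
    and "B \<in> biadjacency_mats E X Y"
  shows "graph_q N E \<le> 2 * num_distinct_eigenvalues (B * transpose_mat B) + 1"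
proof -
  from assms(1) have XY: "X \<union> Y = {..<N}" "X \<inter> Y = {}"
    unfolding bipartite_with_parts_def by auto
  have fin: "finite X" "finite Y"
    using XY(1) by (metis finite_Un finite_lessThan)+
  from assms(7) have B: "B \<in> carrier_mat (card X) (card Y)"
    unfolding biadjacency_mats_def by simp
  let ?c = "map_mat complex_of_real"
  let ?A = "bipartite_matrix N X Y B"
  let ?S = "spectrum (?c (B * transpose_mat B))"
  \<comment> \<open>Passing to complex entries commutes with the construction. The bounds on ranks
    are needed because \<open>map_mat\<close> is only evaluated at indices within range.\<close>
  have "?c ?A = bipartite_matrix N X Y (?c B)"
    using B fin XY(2)
    by (intro eq_matI) (auto simp: bipartite_matrix_def card_less_element)
  moreover have "?c B * transpose_mat (?c B) = ?c (B * transpose_mat B)"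
    using B by (simp add: of_real_hom.mat_hom_mult[of _ "card X" "card Y"] map_mat_transpose)
  ultimately have sub: "spectrum (?c ?A) \<subseteq> insert 0 {k. k\<^sup>2 \<in> ?S}"
    using spectrum_bipartite_matrix_subset[of "?c B", OF _ XY] B by simp
  have "finite ?S"
    using B by (intro card_finite_spectrum(1)[of _ "card X"]) auto
  note square = card_square_preimage_le[OF this]
  have "graph_q N E \<le> num_distinct_eigenvalues ?A"
    unfolding graph_q_def
    by (intro cINF_lower bdd_below_bot bipartite_matrix_in_graph_sym_mats[OF assms(1,7)])
  \<comment> \<open>The inserted 0 accounts for the summand 1 in the bound, the two square roots for
    the factor 2.\<close>
  also have "\<dots> \<le> card (insert 0 {k. k\<^sup>2 \<in> ?S})"
    unfolding num_distinct_eigenvalues_def using sub square(1) by (intro card_mono) auto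
  also have "\<dots> \<le> Suc (card {k. k\<^sup>2 \<in> ?S})"
    by (rule card_insert_le_m1) simp_all
  also have "\<dots> \<le> 2 * card ?S + 1"
    using square(2) by simp
  finally show ?thesis unfolding num_distinct_eigenvalues_def .
qed

end
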